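(* (1) Every linearly H-closed Hausdorff space is feebly compact. (2) Let $X$ be a Hausdorff space, $Y\subset X$ be dense in $X$, and $\kappa$ be an infinite cardinal. Assume that $wL(X)\le\kappa$ and that $Y$ (with the subspace topology) is both initially $\kappa$-linearly Lindelöf and feebly compact. Then $X$ is linearly H-closed.
   Context: A cover always means a cover by open sets; a chain cover is a cover linearly ordered by inclusion. A space $X$ is linearly H-closed if every chain cover of $X$ has a member dense in $X$. A space is feebly compact if every locally finite family of open sets is finite (equivalently, every countable cover has a finite subfamily with dense union). A space is initially $\kappa$-linearly Lindelöf if every chain cover of cardinality $\le\kappa$ has a countable subcover. The weak Lindelöf number $wL(X)$ is the least cardinal $\kappa$ such that every cover of $X$ has a subfamily of cardinality $\le\kappa$ whose union is dense in $X$. *)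

theory Defs
  imports "HOL-Analysis.Analysis"
begin

unbundle cardinal_syntax

definition dense_subset :: "'a topology \<Rightarrow> 'a set \<Rightarrow> bool" where
  "dense_subset X S \<longleftrightarrow> S \<subseteq> topspace X \<and> X closure_of S = topspace X"

definition open_cover :: "'a topology \<Rightarrow> 'a set set \<Rightarrow> bool" where
  "open_cover X \<U> \<longleftrightarrow> (\<forall>U\<in>\<U>. openin X U) \<and> \<Union>\<U> = topspace X"

text \<open>
  Chain covers are taken to be nonempty families. Nonemptiness is automatic unless the space is
  empty; there the empty family would be a chain cover without any member, hence without a dense
  member, and the empty space would fail to be linearly H-closed.
\<close>
definition chain_cover :: "'a topology \<Rightarrow> 'a set set \<Rightarrow> bool" where
  "chain_cover X \<U> \<longleftrightarrow> open_cover X \<U> \<and> \<U> \<noteq> {} \<and> chain\<^sub>\<subseteq> \<U>"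

definition linearly_H_closed :: "'a topology \<Rightarrow> bool" where
  "linearly_H_closed X \<longleftrightarrow> (\<forall>\<U>. chain_cover X \<U> \<longrightarrow> (\<exists>U\<in>\<U>. dense_subset X U))"

definition feebly_compact :: "'a topology \<Rightarrow> bool" where
  "feebly_compact X \<longleftrightarrow>
     (\<forall>\<U>. (\<forall>U\<in>\<U>. openin X U) \<and> locally_finite_in X \<U> \<longrightarrow> finite \<U>)"

text \<open>
  Cardinals are cardinal orders (relations satisfying \<^const>\<open>Card_order\<close>), compared by \<open>\<le>o\<close>.
\<close>
definition initially_linearly_Lindelof :: "'k rel \<Rightarrow> 'a topology \<Rightarrow> bool" where
  "initially_linearly_Lindelof \<kappa> X \<longleftrightarrow>
     (\<forall>\<U>. chain_cover X \<U> \<and> |\<U>| \<le>o \<kappa> \<longrightarrow>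
        (\<exists>\<V>\<subseteq>\<U>. countable \<V> \<and> open_cover X \<V>))"

definition weakly_Lindelof_at :: "'k rel \<Rightarrow> 'a topology \<Rightarrow> bool" where
  "weakly_Lindelof_at \<kappa> X \<longleftrightarrow>
     (\<forall>\<U>. open_cover X \<U> \<longrightarrow> (\<exists>\<V>\<subseteq>\<U>. |\<V>| \<le>o \<kappa> \<and> dense_subset X (\<Union>\<V>)))"

text \<open>
  The least cardinal, determined up to \<open>=o\<close>. It is enough to minimise over cardinal orders on
  \<^typ>\<open>'a set\<close>, because every cover has at most \<open>|UNIV :: 'a set set|\<close> members; the lemma
  \<open>weak_Lindelof_number_le_iff\<close> below confirms leastness among cardinals on all types.
\<close>
definition weak_Lindelof_number :: "'a topology \<Rightarrow> 'a set rel" where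
  "weak_Lindelof_number X =
     (SOME r. Card_order r \<and> weakly_Lindelof_at r X \<and>
        (\<forall>s :: 'a set rel. Card_order s \<and> weakly_Lindelof_at s X \<longrightarrow> r \<le>o s))"

lemma weakly_Lindelof_at_mono:
  assumes "weakly_Lindelof_at r X" "r \<le>o s"
  shows "weakly_Lindelof_at s X"
  unfolding weakly_Lindelof_at_def
proof (intro allI impI)
  fix \<U> assume "open_cover X \<U>"
  then obtain \<V> where "\<V> \<subseteq> \<U>" "|\<V>| \<le>o r" "dense_subset X (\<Union>\<V>)"
    using assms(1) unfolding weakly_Lindelof_at_def by auto
  then show "\<exists>\<V>\<subseteq>\<U>. |\<V>| \<le>o s \<and> dense_subset X (\<Union>\<V>)"
    using ordLeq_transitive[OF _ assms(2)] by auto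
qed

lemma weakly_Lindelof_at_UNIV: "weakly_Lindelof_at |UNIV :: 'a set set| (X :: 'a topology)"
  unfolding weakly_Lindelof_at_def
proof (intro allI impI)
  fix \<U> assume "open_cover X \<U>"
  then have "dense_subset X (\<Union>\<U>)"
    by (simp add: open_cover_def dense_subset_def)
  moreover have "|\<U>| \<le>o |UNIV :: 'a set set|" by (simp add: card_of_mono1)
  ultimately show "\<exists>\<V>\<subseteq>\<U>. |\<V>| \<le>o |UNIV :: 'a set set| \<and> dense_subset X (\<Union>\<V>)"
    by blast
qed

lemma weak_Lindelof_number:
  fixes X :: "'a topology"
  shows "Card_order (weak_Lindelof_number X)"
    and "weakly_Lindelof_at (weak_Lindelof_number X) X"
    and "\<And>s :: 'a set rel. Card_order s \<Longrightarrow> weakly_Lindelof_at s X \<Longrightarrow> weak_Lindelof_number X \<le>o s"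
proof -
  let ?R = "{r :: 'a set rel. Card_order r \<and> weakly_Lindelof_at r X}"
  have "|UNIV :: 'a set set| \<in> ?R"
    using weakly_Lindelof_at_UNIV card_of_Card_order by blast
  then obtain r where "r \<in> ?R" "\<forall>s\<in>?R. r \<le>o s"
    using exists_minim_Card_order[of ?R] by blast
  then have ex: "\<exists>r :: 'a set rel. Card_order r \<and> weakly_Lindelof_at r X \<and>
        (\<forall>s :: 'a set rel. Card_order s \<and> weakly_Lindelof_at s X \<longrightarrow> r \<le>o s)"
    by blast
  note * = someI_ex[OF ex, folded weak_Lindelof_number_def]
  show "Card_order (weak_Lindelof_number X)"
    and "weakly_Lindelof_at (weak_Lindelof_number X) X"
    and "\<And>s :: 'a set rel. Card_order s \<Longrightarrow> weakly_Lindelof_at s X \<Longrightarrow> weak_Lindelof_number X \<le>o s"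
    using * by blast+
qed

lemma weak_Lindelof_number_le_iff:
  fixes X :: "'a topology" and \<kappa> :: "'k rel"
  assumes "Card_order \<kappa>"
  shows "weak_Lindelof_number X \<le>o \<kappa> \<longleftrightarrow> weakly_Lindelof_at \<kappa> X"
proof
  assume "weak_Lindelof_number X \<le>o \<kappa>"
  then show "weakly_Lindelof_at \<kappa> X"
    by (rule weakly_Lindelof_at_mono[OF weak_Lindelof_number(2)])
next
  assume \<kappa>: "weakly_Lindelof_at \<kappa> X"
  let ?U = "|UNIV :: 'a set set|"
  consider "\<kappa> \<le>o ?U" | "?U \<le>o \<kappa>"
    using ordLeq_total[OF card_order_on_well_order_on[OF assms] card_of_Well_order] by blast
  then show "weak_Lindelof_number X \<le>o \<kappa>"
  proof cases
    case 1
    then obtain s :: "'a set rel" where s: "\<kappa> =o s"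
      using internalize_ordLeq[of \<kappa> ?U] by auto
    have "Card_order s"
      by (rule Card_order_ordIso2[OF assms s])
    moreover have "weakly_Lindelof_at s X"
      by (rule weakly_Lindelof_at_mono[OF \<kappa> ordIso_imp_ordLeq[OF s]])
    ultimately have "weak_Lindelof_number X \<le>o s"
      by (rule weak_Lindelof_number(3))
    then show ?thesis
      by (rule ordLeq_ordIso_trans[OF _ ordIso_symmetric[OF s]])
  next
    case 2
    have "weak_Lindelof_number X \<le>o ?U"
      by (intro weak_Lindelof_number(3) card_of_Card_order weakly_Lindelof_at_UNIV)
    then show ?thesis
      by (rule ordLeq_transitive[OF _ 2])
  qed
qed

end

theory Submission
  imports Defs
begin

text \<open>
  An infinite locally finite sequence \<open>f\<close> of nonempty open sets and a countable increasing open cover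
  \<open>W\<close> without dense member produce each other by taking exteriors: of the tails of \<open>f\<close> in one
  direction, of the members of \<open>W\<close> in the other. This gives (1), and the existence of a dense member
  in every countable chain cover of a feebly compact space. For (2), take a subfamily \<open>\<V>\<close> of
  the chain cover with at most \<open>\<kappa>\<close> members and dense union. If some member of the cover contains
  all of \<open>\<V>\<close>, it is dense; otherwise \<open>\<V>\<close> is cofinal, hence itself a chain cover, and its traces on
  \<open>Y\<close> have a countable subcover.
\<close>

lemma linearly_H_closed_imp_feebly_compact:
  assumes "linearly_H_closed X"
  shows "feebly_compact X"
  unfolding feebly_compact_def
proof (intro allI impI, rule ccontr)
  fix \<U> assume \<U>: "(\<forall>U\<in>\<U>. openin X U) \<and> locally_finite_in X \<U>" and "infinite \<U>"
  \<comment> \<open>The empty set is discarded so that every \<open>f n\<close> has a point, which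
    the final contradiction needs.\<close>
  then have "infinite (\<U> - {{}})"
    by simp
  then obtain f :: "nat \<Rightarrow> 'a set" where f: "inj f" "range f \<subseteq> \<U> - {{}}"
    using infinite_countable_subset by metis
  have opf: "openin X (f n)" and nef: "f n \<noteq> {}" for n
    using f(2) \<U> by blast+
  \<comment> \<open>The tails shrink with \<open>n\<close>, so their exteriors increase and form a
    chain.\<close>
  define W where "W n = topspace X - X closure_of (\<Union>m\<in>{n..}. f m)" for n
  have "mono W"
    unfolding W_def by (intro monoI Diff_mono closure_of_mono UN_mono) auto
  then have chain: "chain\<^sub>\<subseteq> (range W)"
    unfolding chain_subset_def by (metis linear monoD rangeE)
  have cov: "\<exists>n. x \<in> W n" if x: "x \<in> topspace X" for x
  proof -
    obtain V where V: "openin X V" "x \<in> V" "finite {U \<in> \<U>. U \<inter> V \<noteq> {}}"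
      using \<U> x unfolding locally_finite_in_def by blast
    \<comment> \<open>Injectivity turns finitely many members meeting \<open>V\<close> into finitely
      many indices, so some tail misses \<open>V\<close> entirely.\<close>
    have "finite (f -` {U \<in> \<U>. U \<inter> V \<noteq> {}})"
      using V(3) f(1) by (rule finite_vimageI)
    then obtain n where n: "\<And>m. m \<in> f -` {U \<in> \<U>. U \<inter> V \<noteq> {}} \<Longrightarrow> m < n"
      using finite_nat_set_iff_bounded by auto
    have "f m \<inter> V = {}" if "n \<le> m" for m
      using n[of m] that f(2) by fastforce
    then have "V \<inter> (\<Union>m\<in>{n..}. f m) = {}"
      by auto
    then have "x \<notin> X closure_of (\<Union>m\<in>{n..}. f m)"
      using V(1,2) unfolding in_closure_of by blast
    then show ?thesis
      using x W_def by blast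
  qed
  have "open_cover X (range W)"
    unfolding open_cover_def using cov by (auto simp: W_def intro: openin_diff)
  then have "chain_cover X (range W)"
    unfolding chain_cover_def using chain by blast
  then obtain n where n: "X closure_of W n = topspace X"
    using assms unfolding linearly_H_closed_def dense_subset_def by blast
  have "(\<Union>m\<in>{n..}. f m) \<subseteq> X closure_of (\<Union>m\<in>{n..}. f m)"
    using opf by (intro closure_of_subset UN_least openin_subset)
  \<comment> \<open>\<open>f n\<close> belongs to the tail starting at \<open>n\<close>. Being open
    and disjoint from \<open>W n\<close>, it also misses the closure of \<open>W n\<close>, which is
    the whole space.\<close>
  then have "f n \<inter> W n = {}"
    unfolding W_def by auto
  then have "f n \<inter> X closure_of W n = {}"
    using openin_Int_closure_of_eq_empty opf by metis
  then show False
    using n nef openin_subset[OF opf] by blast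
qed

text \<open>A finite union in a chain is its largest term. Partial unions thus replace an
  enumeration of a chain by an increasing sequence of members.\<close>

lemma chain_subset_UN_atMost_mem:
  fixes f :: "nat \<Rightarrow> 'a set"
  assumes "chain\<^sub>\<subseteq> \<U>" "range f \<subseteq> \<U>"
  shows "(\<Union>i\<le>n. f i) \<in> \<U>"
proof (induction n)
  case 0
  then show ?case
    using assms by auto
next
  case (Suc n)
  have "f (Suc n) \<in> \<U>"
    using assms by auto
  then have "f (Suc n) \<union> (\<Union>i\<le>n. f i) \<in> \<U>"
    using assms(1) Suc unfolding chain_subset_def by (metis Un_absorb1 Un_absorb2)
  then show ?case
    by (simp add: atMost_Suc)
qed

text \<open>Without a dense member, the exteriors \<open>E n\<close> of the partial unions would be
  a decreasing, locally finite sequence of nonempty open sets with no common point.\<close>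

lemma feebly_compact_countable_chain_cover:
  assumes fc: "feebly_compact X" and "chain_cover X \<U>" "countable \<U>"
  shows "\<exists>U\<in>\<U>. dense_subset X U"
proof (rule ccontr)
  assume nd: "\<not> (\<exists>U\<in>\<U>. dense_subset X U)"
  have \<U>: "\<forall>U\<in>\<U>. openin X U" "\<Union>\<U> = topspace X" "\<U> \<noteq> {}" "chain\<^sub>\<subseteq> \<U>"
    using assms(2) unfolding chain_cover_def open_cover_def by auto
  define f where "f = from_nat_into \<U>"
  have rf: "range f = \<U>"
    unfolding f_def using \<U>(3) assms(3) by (rule range_from_nat_into)
  define W where "W n = (\<Union>i\<le>n. f i)" for n
  define E where "E n = topspace X - X closure_of W n" for n
  have W: "W n \<in> \<U>" for n
    unfolding W_def using chain_subset_UN_atMost_mem \<U>(4) rf by blast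
  have WX: "W n \<subseteq> topspace X" for n
    using W \<U>(2) by blast
  have ne: "E n \<noteq> {}" for n
    using nd W[of n] WX[of n] closure_of_subset_topspace[of X "W n"]
    unfolding E_def dense_subset_def by auto
  have anti: "E n \<subseteq> E m" if "m \<le> n" for m n
    unfolding E_def W_def using that by (intro Diff_mono closure_of_mono UN_mono) auto
  have disj: "W k \<inter> E n = {}" if "k \<le> n" for k n
    using anti[OF that] closure_of_subset[OF WX[of k]] unfolding E_def by blast
  have cov: "\<exists>k. x \<in> W k" if "x \<in> topspace X" for x
  proof -
    have "x \<in> \<Union>(range f)"
      using that by (simp add: rf \<U>(2))
    then show ?thesis
      unfolding W_def by blast
  qed
  have "locally_finite_in X (range E)"
    unfolding locally_finite_in_def
  proof (intro conjI ballI)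
    show "\<Union>(range E) \<subseteq> topspace X"
      unfolding E_def by blast
    fix x assume "x \<in> topspace X"
    then obtain k where k: "x \<in> W k"
      using cov by blast
    \<comment> \<open>\<open>W k\<close> itself is the neighbourhood witnessing local finiteness at
      \<open>x\<close>.\<close>
    have "n < k" if "E n \<inter> W k \<noteq> {}" for n
      using disj[of k n] that by (metis Int_commute linorder_not_le)
    then have "{U \<in> range E. U \<inter> W k \<noteq> {}} \<subseteq> E ` {..<k}"
      by auto
    then have "finite {U \<in> range E. U \<inter> W k \<noteq> {}}"
      by (rule finite_subset) simp
    then show "\<exists>V. openin X V \<and> x \<in> V \<and> finite {U \<in> range E. U \<inter> V \<noteq> {}}"
      using k W \<U>(1) by blast
  qed
  moreover have "\<forall>U\<in>range E. openin X U"
    unfolding E_def by auto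
  ultimately have "finite (range E)"
    using fc unfolding feebly_compact_def by blast
  \<comment> \<open>Finiteness of \<open>range E\<close> only says that \<open>E\<close> takes
    finitely many values. As \<open>E\<close> decreases, a minimal value lies inside all the others,
    and any point of it is common to every \<open>E n\<close>.\<close>
  then obtain m where min: "\<And>n. E n \<subseteq> E m \<Longrightarrow> E m = E n"
    using finite_has_minimal[of "range E"] by auto
  have m: "E m \<subseteq> E n" for n
    using min anti by (cases "m \<le> n") auto
  obtain x where "x \<in> E m"
    using ne by blast
  moreover then obtain k where "x \<in> W k"
    using cov unfolding E_def by blast
  ultimately show False
    using m[of k] disj[of k k] by blast
qed

text \<open>The closure of \<open>U\<close> in \<open>X\<close> contains \<open>Y\<close>, and
  therefore the closure of \<open>Y\<close>, which is everything.\<close>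

lemma dense_subset_of_dense_trace:
  assumes "dense_subset X Y" "dense_subset (subtopology X Y) (Y \<inter> U)" "U \<subseteq> topspace X"
  shows "dense_subset X U"
proof -
  have Y: "Y \<subseteq> topspace X" "X closure_of Y = topspace X"
    using assms(1) unfolding dense_subset_def by auto
  have "Y \<subseteq> X closure_of (Y \<inter> U)"
    using assms(2) Y(1) unfolding dense_subset_def
    by (auto simp: closure_of_subtopology topspace_subtopology)
  also have "\<dots> \<subseteq> X closure_of U"
    by (intro closure_of_mono) blast
  finally have "X closure_of Y \<subseteq> X closure_of U"
    by (rule closure_of_minimal) simp
  then show ?thesis
    using Y(2) assms(3) closure_of_subset_topspace[of X U] unfolding dense_subset_def by simp
qed

lemma chain_cover_subtopology:
  assumes "chain_cover X \<U>"
  shows "chain_cover (subtopology X Y) ((\<inter>) Y ` \<U>)"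
proof -
  have "chain\<^sub>\<subseteq> ((\<inter>) Y ` \<U>)"
    unfolding chain_subset_def
  proof (intro ballI; elim imageE; hypsubst)
    fix U V assume "U \<in> \<U>" "V \<in> \<U>"
    then have "U \<subseteq> V \<or> V \<subseteq> U"
      using assms unfolding chain_cover_def chain_subset_def by simp
    then show "Y \<inter> U \<subseteq> Y \<inter> V \<or> Y \<inter> V \<subseteq> Y \<inter> U"
      by blast
  qed
  moreover have "open_cover (subtopology X Y) ((\<inter>) Y ` \<U>)"
    using assms unfolding chain_cover_def open_cover_def
    by (auto simp: topspace_subtopology openin_subtopology_Int2)
  ultimately show ?thesis
    using assms unfolding chain_cover_def by simp
qed

lemma dense_subset_superset:
  assumes "dense_subset X S" "S \<subseteq> T" "T \<subseteq> topspace X"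
  shows "dense_subset X T"
proof -
  have "topspace X \<subseteq> X closure_of T"
    using assms(1) closure_of_mono[OF assms(2), of X] unfolding dense_subset_def by simp
  then show ?thesis
    using assms(3) closure_of_subset_topspace[of X T] unfolding dense_subset_def by simp
qed

text \<open>The cardinal \<open>\<kappa>\<close> links two hypotheses: it bounds the dense
  subfamily, and it is the size up to which chain covers of \<open>Y\<close> have countable
  subcovers.\<close>

lemma linearly_H_closed_if_dense_subspace:
  assumes Y: "dense_subset X Y"
    and wL: "weakly_Lindelof_at \<kappa> X"
    and iL: "initially_linearly_Lindelof \<kappa> (subtopology X Y)"
    and fc: "feebly_compact (subtopology X Y)"
  shows "linearly_H_closed X"
  unfolding linearly_H_closed_def
proof (intro allI impI)
  fix \<U> assume "chain_cover X \<U>"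
  then have \<U>: "\<forall>U\<in>\<U>. openin X U" "\<Union>\<U> = topspace X" "\<U> \<noteq> {}" "chain\<^sub>\<subseteq> \<U>"
    and oc: "open_cover X \<U>"
    unfolding chain_cover_def open_cover_def by auto
  have sub: "U \<subseteq> topspace X" if "U \<in> \<U>" for U
    using \<U>(1) that by (blast dest: openin_subset)
  obtain \<V> where \<V>: "\<V> \<subseteq> \<U>" "|\<V>| \<le>o \<kappa>" "dense_subset X (\<Union>\<V>)"
    using wL oc unfolding weakly_Lindelof_at_def by blast
  show "\<exists>U\<in>\<U>. dense_subset X U"
  proof (cases "\<exists>U\<in>\<U>. \<Union>\<V> \<subseteq> U")
    case True
    then obtain U where "U \<in> \<U>" "\<Union>\<V> \<subseteq> U"
      by (elim bexE)
    then show ?thesis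
      using dense_subset_superset[OF \<V>(3) _ sub] by (intro bexI)
  next
    case False
    have cofinal: "\<exists>V\<in>\<V>. U \<subseteq> V" if U: "U \<in> \<U>" for U
    proof -
      have "\<not> \<Union>\<V> \<subseteq> U"
        using False U by simp
      \<comment> \<open>Comparability in the chain turns a member not inside \<open>U\<close> into
        one containing \<open>U\<close>.\<close>
      then obtain V where V: "V \<in> \<V>" "\<not> V \<subseteq> U"
        by (auto simp: Sup_le_iff)
      then have "U \<subseteq> V"
        using U \<U>(4) subsetD[OF \<V>(1)] unfolding chain_subset_def by metis
      with V(1) show ?thesis
        by (intro bexI)
    qed
    then have "\<Union>\<U> \<subseteq> \<Union>\<V>"
      by (intro Union_least) (meson Union_upper subset_trans)
    then have "\<Union>\<V> = topspace X"
      using \<U>(2) Union_mono[OF \<V>(1)] by simp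
    moreover have "\<V> \<noteq> {}"
      using cofinal \<U>(3) by blast
    ultimately have "chain_cover X \<V>"
      using \<U>(1,4) \<V>(1) unfolding chain_cover_def open_cover_def chain_subset_def
      by (simp add: subset_iff)
    then have cc: "chain_cover (subtopology X Y) ((\<inter>) Y ` \<V>)"
      by (rule chain_cover_subtopology)
    moreover have "|(\<inter>) Y ` \<V>| \<le>o \<kappa>"
      using card_of_image \<V>(2) by (rule ordLeq_transitive)
    ultimately obtain \<C> where \<C>: "\<C> \<subseteq> (\<inter>) Y ` \<V>" "countable \<C>"
        "open_cover (subtopology X Y) \<C>"
      using iL unfolding initially_linearly_Lindelof_def by blast
    obtain V where V: "V \<in> \<V>"
      using \<open>\<V> \<noteq> {}\<close> by blast
    \<comment> \<open>If \<open>Y\<close> is empty, then \<open>\<C>\<close> may be empty, which chain covers are not.\<close>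
    define \<D> where "\<D> = insert (Y \<inter> V) \<C>"
    have \<D>: "\<D> \<subseteq> (\<inter>) Y ` \<V>" "\<D> \<noteq> {}"
      unfolding \<D>_def using \<C>(1) V by auto
    have "\<Union>\<D> = topspace (subtopology X Y)"
      using \<C>(3) sub \<V>(1) V unfolding open_cover_def \<D>_def by auto
    moreover have "\<forall>D\<in>\<D>. openin (subtopology X Y) D" "chain\<^sub>\<subseteq> \<D>"
      using cc \<D>(1) unfolding chain_cover_def open_cover_def chain_subset_def
      by (meson subsetD)+
    ultimately have "chain_cover (subtopology X Y) \<D>"
      using \<D>(2) unfolding chain_cover_def open_cover_def by simp
    moreover have "countable \<D>"
      unfolding \<D>_def using \<C>(2) by simp
    \<comment> \<open>The countable family covers only \<open>Y\<close>, so the dense member is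
      found within \<open>Y\<close> and its density is then lifted to \<open>X\<close>.\<close>
    ultimately obtain D where "D \<in> \<D>" "dense_subset (subtopology X Y) D"
      using feebly_compact_countable_chain_cover fc by blast
    then obtain U where "U \<in> \<V>" "dense_subset (subtopology X Y) (Y \<inter> U)"
      using \<D>(1) by blast
    then show ?thesis
      using dense_subset_of_dense_trace[OF Y] \<V>(1) sub by blast
  qed
qed

theorem lemma2p4:
  shows "(\<forall>Z :: 'b topology. Hausdorff_space Z \<and> linearly_H_closed Z \<longrightarrow> feebly_compact Z) \<and>
    (\<forall>(X :: 'a topology) Y (\<kappa> :: 'k rel).
       Hausdorff_space X \<and> Y \<subseteq> topspace X \<and> dense_subset X Y \<and> Cinfinite \<kappa> \<and>
       weak_Lindelof_number X \<le>o \<kappa> \<and>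
       initially_linearly_Lindelof \<kappa> (subtopology X Y) \<and>
       feebly_compact (subtopology X Y)
       \<longrightarrow> linearly_H_closed X)"
proof (intro conjI allI impI; elim conjE)
  fix Z :: "'b topology" assume "linearly_H_closed Z"
  then show "feebly_compact Z"
    by (rule linearly_H_closed_imp_feebly_compact)
next
  fix X :: "'a topology" and Y and \<kappa> :: "'k rel"
  assume Y: "dense_subset X Y" "initially_linearly_Lindelof \<kappa> (subtopology X Y)"
      "feebly_compact (subtopology X Y)"
    and wL: "weak_Lindelof_number X \<le>o \<kappa>"
  have "weakly_Lindelof_at \<kappa> X"
    using weak_Lindelof_number(2) wL by (rule weakly_Lindelof_at_mono)
  then show "linearly_H_closed X"
    using Y by (intro linearly_H_closed_if_dense_subspace)
qed

end
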